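(* Let $F$ be a field and let $A_1,\dots,A_m$ ($m\ge 1$) be square matrices over $F$, of possibly different orders, with minimal polynomials $\mathcal M_{A_i}(X)=X^{\iota_{A_i}(0)}Q_i(X)$, where $Q_i$ is monic with $Q_i(0)\neq 0$ and $\iota_{A_i}(0)\geq 0$. Put $\Theta=\{i : 1\le i\le m,\ Q_i=1\}$. Then the minimal polynomial of the Kronecker product $A_1\otimes\cdots\otimes A_m$ is $$X^{\rho}\,\Upsilon(Q_1,\dots,Q_m),$$ where $$\rho=\begin{cases}\min\{\iota_{A_i}(0): i\in\Theta\} & \text{if }\Theta\neq\emptyset,\\ \max\{\iota_{A_i}(0): 1\le i\le m\} & \text{otherwise.}\end{cases}$$
   Context: For positive integers $s,t$, $s\wedge t$ denotes the maximum value of $i+j+1$ over all $0\le i\le s-1$, $0\le j\le t-1$ such that $\binom{i+j}{i}\neq 0$ in $F$; moreover $0\wedge s=s\wedge 0=0$ for all $s\in\mathbb N$ (nonnegative integers). Write $\wedge_m(t_1,\dots,t_m)=t_1\wedge\cdots\wedge t_m$ for $t_i\in\mathbb N$ (iterated operation). Let $\overline F$ be the algebraic closure of $F$ and $\overline F^{\star}=\overline F\setminus\{0\}$. Define an equivalence relation $\mathcal R$ on $(\overline F^{\star})^m$ by $(\lambda_1,\dots,\lambda_m)\,\mathcal R\,(\mu_1,\dots,\mu_m)$ iff $\lambda_1\cdots\lambda_m=\mu_1\cdots\mu_m$, and let $(\Omega_i)_{i\in T}$ be its equivalence classes. Let $\widehat\Omega_i=\mu_1\cdots\mu_m$ for any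 $(\mu_1,\dots,\mu_m)\in\Omega_i$. For monic polynomials $P_1,\dots,P_m$ over $F$, let $\lambda(P_i)$ be the multiplicity of $\lambda$ as a root of $P_i$ ($0$ if $\lambda$ is not a root), let $f(\lambda_1,\dots,\lambda_m)=(\lambda_1(P_1),\dots,\lambda_m(P_m))$, $\overline f=\wedge_m\circ f$, and $\Omega_i^f=\max_{(\mu_1,\dots,\mu_m)\in\Omega_i}\overline f(\mu_1,\dots,\mu_m)$. Then $$\Upsilon(P_1,\dots,P_m)=\prod_{i\in T}(X-\widehat\Omega_i)^{\Omega_i^f}$$ (all but finitely many exponents are $0$). *)

theory Defs
  imports "Jordan_Normal_Form.Matrix" "HOL-Algebra.Algebraic_Closure_Type"
begin

section \<open>Minimal polynomials of square matrices\<close>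

text \<open>
  The value \<open>p(A)\<close>. It is written entrywise because type \<open>mat\<close> has no fixed dimensions, hence no
  zero element and no \<open>sum\<close>.
\<close>
definition mat_eval :: "'a :: comm_ring_1 poly \<Rightarrow> 'a mat \<Rightarrow> 'a mat" where
  "mat_eval p A = mat (dim_row A) (dim_row A)
     (\<lambda>ij. \<Sum>k\<le>degree p. coeff p k * (A ^\<^sub>m k) $$ ij)"

definition annihilates :: "'a :: comm_ring_1 poly \<Rightarrow> 'a mat \<Rightarrow> bool" where
  "annihilates p A \<longleftrightarrow> mat_eval p A = 0\<^sub>m (dim_row A) (dim_row A)"

text \<open>Meaningful for square matrices only; for these the description determines \<open>p\<close> uniquely.\<close>
definition minimal_poly :: "'a :: field mat \<Rightarrow> 'a poly" where
  "minimal_poly A = (THE p. lead_coeff p = 1 \<and> annihilates p A \<and>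
     (\<forall>q. q \<noteq> 0 \<and> annihilates q A \<longrightarrow> degree p \<le> degree q))"


section \<open>Kronecker products\<close>

definition kronecker :: "'a :: times mat \<Rightarrow> 'a mat \<Rightarrow> 'a mat" where
  "kronecker A B = mat (dim_row A * dim_row B) (dim_col A * dim_col B)
     (\<lambda>(i, j). A $$ (i div dim_row B, j div dim_col B) * B $$ (i mod dim_row B, j mod dim_col B))"

text \<open>For nonempty lists, associating to the left (and likewise \<open>wedges\<close> below).\<close>
definition kronecker_list :: "'a :: times mat list \<Rightarrow> 'a mat" where
  "kronecker_list As = foldl kronecker (hd As) (tl As)"


section \<open>The operation \<open>\<and>\<close>\<close>

text \<open>It depends on the field (only through its characteristic), passed as a type argument.\<close>
definition wedge :: "'a :: field itself \<Rightarrow> nat \<Rightarrow> nat \<Rightarrow> nat" where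
  "wedge F s t = (if s = 0 \<or> t = 0 then 0
     else Max {i + j + 1 | i j. i \<le> s - 1 \<and> j \<le> t - 1 \<and> of_nat ((i + j) choose i) \<noteq> (0 :: 'a)})"

definition wedges :: "'a :: field itself \<Rightarrow> nat list \<Rightarrow> nat" where
  "wedges F ts = foldl (wedge F) (hd ts) (tl ts)"


section \<open>The polynomial \<open>\<Upsilon>\<close>\<close>

text \<open>Elements of \<open>K\<^sup>m\<close> are lists of length \<open>m\<close>.\<close>
definition nonzero_tuples :: "nat \<Rightarrow> 'b :: field list set" where
  "nonzero_tuples m = {xs. length xs = m \<and> 0 \<notin> set xs}"

definition same_product :: "nat \<Rightarrow> ('b :: field list \<times> 'b list) set" where
  "same_product m = {(xs, ys). xs \<in> nonzero_tuples m \<and> ys \<in> nonzero_tuples m \<and>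
     prod_list xs = prod_list ys}"

definition product_classes :: "nat \<Rightarrow> 'b :: field list set set" where
  "product_classes m = nonzero_tuples m // same_product m"

text \<open>All members of a class have the same product, so the choice is immaterial.\<close>
definition class_product :: "'b :: field list set \<Rightarrow> 'b" where
  "class_product \<Omega> = prod_list (SOME \<mu>. \<mu> \<in> \<Omega>)"

definition root_multiplicity :: "'a :: field poly \<Rightarrow> 'a alg_closure \<Rightarrow> nat" where
  "root_multiplicity P x = order x (map_poly to_ac P)"

definition wedge_multiplicity :: "'a :: field poly list \<Rightarrow> 'a alg_closure list \<Rightarrow> nat" where
  "wedge_multiplicity Ps xs = wedges TYPE('a) (map2 root_multiplicity Ps xs)"

text \<open>
  A class may be infinite, but for nonzero polynomials \<open>wedge_multiplicity\<close> takes finitely many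
  values on it.
\<close>
definition class_exponent :: "'a :: field poly list \<Rightarrow> 'a alg_closure list set \<Rightarrow> nat" where
  "class_exponent Ps \<Omega> = Max (wedge_multiplicity Ps ` \<Omega>)"

text \<open>
  The product runs over the classes with nonzero exponent, of which there are finitely many; a
  \<open>prod\<close> over the possibly infinite set of all classes would be 1 by convention.
\<close>
definition Upsilon :: "'a :: field poly list \<Rightarrow> 'a alg_closure poly" where
  "Upsilon Ps = (\<Prod>\<Omega> \<in> {\<Omega> \<in> product_classes (length Ps). class_exponent Ps \<Omega> \<noteq> 0}.
     [:- class_product \<Omega>, 1:] ^ class_exponent Ps \<Omega>)"

end

theory Submission
  imports Defs "Jordan_Normal_Form.Char_Poly"
begin

text \<open>
  Over an algebraically closed field, a polynomial is annihilating for \<open>A\<close> iff it is divisible by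
  \<open>(X - x)^s\<close> for each root \<open>x\<close> of the minimal polynomial, \<open>s\<close> being the multiplicity of \<open>x\<close>.
  Divisibility of \<open>p = \<Sum>k. p\<^sub>k X^k\<close> by \<open>(X - x)^s\<close> is linear in the coefficients: it says that \<open>p\<close> pairs
  to zero with the sequences \<open>k \<mapsto> (k choose i) x^(k-i)\<close>, \<open>i < s\<close>, under the pairing \<open>\<Sum>k. p\<^sub>k a\<^sub>k\<close>. Likewise
  \<open>p(A) = 0\<close> says that \<open>p\<close> pairs to zero with the sequences of entries of \<open>A^k\<close>. As
  \<open>(A \<otimes> B)^k = A^k \<otimes> B^k\<close>, the polynomial \<open>p\<close> annihilates \<open>A \<otimes> B\<close> iff it pairs to zero with all products
  of an entry sequence of \<open>A\<close> and one of \<open>B\<close>. Fixing one factor and absorbing it into the coefficients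
  of \<open>p\<close> leaves a statement about the other matrix alone, so the entry sequences can be traded, first
  for \<open>A\<close> and then for \<open>B\<close>, for the sequences attached to the roots.

  It remains to find, for fixed roots \<open>x\<close>, \<open>y\<close> of multiplicities \<open>s\<close>, \<open>t\<close>, which \<open>p\<close> pair to zero with the
  products \<open>(k choose i) x^(k-i) (k choose j) y^(k-j)\<close>, \<open>i < s\<close>, \<open>j < t\<close>. By Vandermonde's identity such a
  product is a combination of the sequences attached to \<open>x y\<close> with indices between \<open>max i j\<close> and
  \<open>i + j\<close>, and the coefficient at \<open>i + j\<close> is \<open>(i + j choose i) x^j y^i\<close>. If \<open>x\<close>, \<open>y\<close> are nonzero, this gives
  precisely the divisibility by \<open>(X - x y)^(s \<and> t)\<close> (\<open>pairing_jordan_mult_iff_wedge\<close>). If one of them is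
  zero, its sequences are unit vectors and the exponent is immediate. So the multiplicity of \<open>z\<close> in
  the minimal polynomial of \<open>A \<otimes> B\<close> is the largest exponent contributed by the pairs with \<open>x y = z\<close>.

  The general case is an induction on the number of factors. At a nonzero \<open>z\<close>, monotonicity of \<open>\<and>\<close>
  makes the iterated maximum a maximum over tuples. At zero, one follows at the same time whether
  there are nonzero eigenvalues at all: a factor without them caps the multiplicity of zero, while any
  other factor leaves the contribution of its partner unchanged.

  The passage to the algebraic closure is harmless because minimal polynomials do not change under
  field extension (\<open>minimal_poly_to_ac\<close>). Finally two monic polynomials over an algebraically closed
  field agree if all roots have the same multiplicities.
\<close>

section \<open>Pairing polynomials with sequences\<close>

definition pairing :: "'a :: comm_ring_1 poly \<Rightarrow> (nat \<Rightarrow> 'a) \<Rightarrow> 'a" where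
  "pairing p a = (\<Sum>k\<le>degree p. coeff p k * a k)"

lemma pairing_eq_sum: "degree p \<le> N \<Longrightarrow> pairing p a = (\<Sum>k\<le>N. coeff p k * a k)"
  unfolding pairing_def by (intro sum.mono_neutral_left) (auto simp: coeff_eq_0)

lemma pairing_0 [simp]: "pairing 0 a = 0"
  by (simp add: pairing_def)

lemma pairing_add: "pairing (p + q) a = pairing p a + pairing q a"
proof -
  define N where "N = max (degree p) (degree q)"
  have "degree p \<le> N" "degree q \<le> N" "degree (p + q) \<le> N"
    by (auto simp: N_def degree_add_le)
  then show ?thesis
    by (simp add: pairing_eq_sum distrib_right sum.distrib)
qed

lemma pairing_smult: "pairing (smult c p) a = c * pairing p a"
  using pairing_eq_sum[OF degree_smult_le, of c p a]
  by (simp add: pairing_def sum_distrib_left mult.assoc)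

lemma pairing_pCons: "pairing (pCons c p) a = c * a 0 + pairing p (\<lambda>k. a (Suc k))"
proof -
  have "pairing (pCons c p) a = (\<Sum>k\<le>Suc (degree p). coeff (pCons c p) k * a k)"
    by (rule pairing_eq_sum) (rule degree_pCons_le)
  also have "\<dots> = c * a 0 + pairing p (\<lambda>k. a (Suc k))"
    by (simp add: sum.atMost_Suc_shift pairing_def del: sum.atMost_Suc)
  finally show ?thesis .
qed

lemma pairing_sum_right: "pairing p (\<lambda>k. \<Sum>r\<in>I. c r * a r k) = (\<Sum>r\<in>I. c r * pairing p (a r))"
proof -
  have "pairing p (\<lambda>k. \<Sum>r\<in>I. c r * a r k) = (\<Sum>k\<le>degree p. \<Sum>r\<in>I. c r * (coeff p k * a r k))"
    by (simp add: pairing_def sum_distrib_left mult.left_commute)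
  also have "\<dots> = (\<Sum>r\<in>I. \<Sum>k\<le>degree p. c r * (coeff p k * a r k))"
    by (rule sum.swap)
  finally show ?thesis by (simp add: pairing_def sum_distrib_left)
qed

text \<open>
  Absorbing one factor of a product of sequences into the polynomial. This is how the two factors of
  a Kronecker product are separated.
\<close>
definition scale_coeffs :: "(nat \<Rightarrow> 'a) \<Rightarrow> 'a :: comm_ring_1 poly \<Rightarrow> 'a poly" where
  "scale_coeffs a p = (\<Sum>k\<le>degree p. monom (coeff p k * a k) k)"

lemma coeff_scale_coeffs: "coeff (scale_coeffs a p) k = coeff p k * a k"
  by (simp add: scale_coeffs_def coeff_sum coeff_eq_0)

lemma pairing_scale_coeffs: "pairing (scale_coeffs a p) b = pairing p (\<lambda>k. a k * b k)"
proof -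
  have "degree (scale_coeffs a p) \<le> degree p"
    by (rule degree_le) (simp add: coeff_scale_coeffs coeff_eq_0)
  then have "pairing (scale_coeffs a p) b = (\<Sum>k\<le>degree p. coeff (scale_coeffs a p) k * b k)"
    by (rule pairing_eq_sum)
  then show ?thesis by (simp add: coeff_scale_coeffs pairing_def mult.assoc)
qed

text \<open>
  For a Jordan block with eigenvalue \<open>x\<close>, this is the value on the \<open>i\<close>-th superdiagonal of its \<open>k\<close>-th power.
  For \<open>k < i\<close> the truncated exponent does no harm, since the binomial coefficient vanishes.
\<close>
definition jordan_seq :: "'a :: comm_ring_1 \<Rightarrow> nat \<Rightarrow> nat \<Rightarrow> 'a" where
  "jordan_seq x i k = of_nat (k choose i) * x ^ (k - i)"

lemma jordan_seq_Suc_0: "jordan_seq x 0 (Suc k) = x * jordan_seq x 0 k"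
  by (simp add: jordan_seq_def)

lemma jordan_seq_Suc_Suc:
  "jordan_seq x (Suc i) (Suc k) = jordan_seq x i k + x * jordan_seq x (Suc i) k"
proof (cases "i < k")
  case True
  then have "k - i = Suc (k - Suc i)" by simp
  then show ?thesis by (simp add: jordan_seq_def algebra_simps)
qed (simp add: jordan_seq_def binomial_eq_0)

text \<open>
  The pairing is the \<open>i\<close>-th Taylor coefficient at \<open>x\<close>, in any characteristic, because the factorial that
  would have to be inverted in the \<open>i\<close>-th derivative is already cancelled in the binomial coefficient.
\<close>
lemma pairing_jordan_seq: "pairing p (jordan_seq x i) = coeff (pcompose p [:x, 1:]) i"
proof (induction p arbitrary: i rule: pCons_induct)
  case 0
  then show ?case by simp
next
  case (pCons c p)
  have lin: "pairing p (\<lambda>k. u k + x * v k) = pairing p u + x * pairing p v" for u v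
    by (simp add: pairing_def sum.distrib sum_distrib_left algebra_simps)
  show ?case
  proof (cases i)
    case 0
    have "pairing p (\<lambda>k. jordan_seq x 0 (Suc k)) = x * pairing p (jordan_seq x 0)"
      using lin[of "\<lambda>_. 0" "jordan_seq x 0"] by (simp add: jordan_seq_Suc_0 pairing_def)
    then show ?thesis
      using 0 pCons.IH[of 0] by (simp add: pairing_pCons pcompose_pCons jordan_seq_def)
  next
    case (Suc j)
    have "pairing p (\<lambda>k. jordan_seq x i (Suc k))
        = pairing p (jordan_seq x j) + x * pairing p (jordan_seq x i)"
      using lin[of "jordan_seq x j" "jordan_seq x i"] by (simp add: Suc jordan_seq_Suc_Suc)
    moreover have "jordan_seq x i 0 = 0" by (simp add: Suc jordan_seq_def)
    ultimately show ?thesis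
      using pCons.IH[of j] pCons.IH[of i]
      by (simp add: pairing_pCons pcompose_pCons Suc coeff_pCons)
  qed
qed

lemma root_power_dvd_iff_pairing:
  "[:- x, 1:] ^ s dvd p \<longleftrightarrow> (\<forall>i<s. pairing p (jordan_seq x i) = 0)"
proof -
  have "[:- x, 1:] ^ s dvd p \<longleftrightarrow> monom 1 s dvd pcompose p [:x, 1:]"
  proof
    assume "[:- x, 1:] ^ s dvd p"
    then obtain r where "p = [:- x, 1:] ^ s * r" ..
    then have "pcompose p [:x, 1:] = monom 1 s * pcompose r [:x, 1:]"
      by (simp add: pcompose_mult pcompose_hom.hom_power pcompose_pCons monom_altdef)
    then show "monom 1 s dvd pcompose p [:x, 1:]" by simp
  next
    assume "monom 1 s dvd pcompose p [:x, 1:]"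
    then obtain r where "pcompose p [:x, 1:] = monom 1 s * r" ..
    then have "pcompose (pcompose p [:x, 1:]) [:- x, 1:] = [:- x, 1:] ^ s * pcompose r [:- x, 1:]"
      by (simp add: pcompose_mult pcompose_hom.hom_power pcompose_pCons monom_altdef)
    moreover have "pcompose (pcompose p [:x, 1:]) [:- x, 1:] = p"
      by (simp add: pcompose_assoc[symmetric] pcompose_pCons)
    ultimately show "[:- x, 1:] ^ s dvd p" by simp
  qed
  then show ?thesis by (simp add: monom_1_dvd_iff' pairing_jordan_seq)
qed

section \<open>Annihilating polynomials and divisibility\<close>

lemma annihilates_iff_pairing:
  assumes "A \<in> carrier_mat n n"
  shows "annihilates p A \<longleftrightarrow> (\<forall>i<n. \<forall>j<n. pairing p (\<lambda>k. (A ^\<^sub>m k) $$ (i, j)) = 0)"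
  using assms by (auto simp: annihilates_def mat_eval_def pairing_def mat_eq_iff)

lemma annihilates_0: "annihilates 0 A"
  by (auto simp: annihilates_def mat_eval_def)

lemma annihilates_add:
  assumes "A \<in> carrier_mat n n" "annihilates p A" "annihilates q A"
  shows "annihilates (p + q) A"
  using assms by (simp add: annihilates_iff_pairing pairing_add)

lemma annihilates_smult:
  assumes "A \<in> carrier_mat n n" "annihilates p A"
  shows "annihilates (smult c p) A"
  using assms by (simp add: annihilates_iff_pairing pairing_smult)

lemma annihilates_pCons_0:
  assumes A: "A \<in> carrier_mat n n" and p: "annihilates p A"
  shows "annihilates (pCons 0 p) A"
proof -
  have "pairing p (\<lambda>k. (A ^\<^sub>m Suc k) $$ (i, j)) = 0" if "i < n" "j < n" for i j
  proof -
    have "(A ^\<^sub>m Suc k) $$ (i, j) = (\<Sum>l = 0..<n. A $$ (l, j) * (A ^\<^sub>m k) $$ (i, l))" for k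
      using A that by (simp add: scalar_prod_def mult.commute)
    then have "pairing p (\<lambda>k. (A ^\<^sub>m Suc k) $$ (i, j))
        = (\<Sum>l = 0..<n. A $$ (l, j) * pairing p (\<lambda>k. (A ^\<^sub>m k) $$ (i, l)))"
      by (simp only: pairing_sum_right)
    also have "\<dots> = 0"
      using p A that by (auto simp: annihilates_iff_pairing intro!: sum.neutral)
    finally show ?thesis .
  qed
  then show ?thesis using A by (simp add: annihilates_iff_pairing pairing_pCons)
qed

lemma annihilates_mult:
  assumes A: "A \<in> carrier_mat n n" and p: "annihilates p A"
  shows "annihilates (q * p) A"
proof (induction q)
  case 0
  then show ?case by (simp add: annihilates_0)
next
  case (pCons c q)
  then show ?case
    by (simp add: mult_pCons_left annihilates_add[OF A] annihilates_smult[OF A p]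
        annihilates_pCons_0[OF A])
qed

text \<open>
  The \<open>n\<^sup>2 + 1\<close> powers up to exponent \<open>n\<^sup>2\<close> are linearly dependent. In the proof the powers are the columns
  of a matrix that is made square by adding a zero row, so its determinant vanishes and a vector in
  the kernel has the coefficients of the polynomial as its entries.
\<close>
lemma ex_annihilating_poly:
  assumes A: "(A :: 'a :: field mat) \<in> carrier_mat n n"
  shows "\<exists>p. p \<noteq> 0 \<and> annihilates p A"
proof -
  define N where "N = Suc (n * n)"
  define R where "R = mat N N (\<lambda>(r, k). if r < n * n then (A ^\<^sub>m k) $$ (r div n, r mod n) else 0)"
  have R: "R \<in> carrier_mat N N" by (simp add: R_def)
  have "det R = 0"
  proof -
    have "(\<Prod>i = 0..<N. R $$ (i, \<pi> i)) = 0" if "\<pi> permutes {0..<N}" for \<pi>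
    proof (rule prod_zero)
      have "\<pi> (n * n) < N" using permutes_in_image[OF that, of "n * n"] by (simp add: N_def)
      then show "\<exists>i\<in>{0..<N}. R $$ (i, \<pi> i) = 0"
        by (intro bexI[of _ "n * n"]) (auto simp: R_def N_def)
    qed simp
    then show ?thesis
      unfolding det_def'[OF R] by (intro sum.neutral) (simp del: prod_zero_iff)
  qed
  then obtain v where v: "v \<in> carrier_vec N" "v \<noteq> 0\<^sub>v N" "R *\<^sub>v v = 0\<^sub>v N"
    using det_0_iff_vec_prod_zero[OF R] by auto
  define p where "p = (\<Sum>k<N. monom (v $ k) k)"
  have coeff_p: "coeff p k = (if k < N then v $ k else 0)" for k
    by (simp add: p_def coeff_sum)
  have "p \<noteq> 0"
  proof
    assume "p = 0"
    then have "v $ k = 0" if "k < N" for k using coeff_p[of k] that by simp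
    then have "v = 0\<^sub>v N" using v by auto
    then show False using v by simp
  qed
  moreover have "annihilates p A"
    unfolding annihilates_iff_pairing[OF A]
  proof (intro allI impI)
    fix i j assume ij: "i < n" "j < n"
    define r where "r = i * n + j"
    have "r < Suc i * n" using ij by (simp add: r_def)
    also have "\<dots> \<le> n * n" using ij by (intro mult_le_mono) auto
    finally have r: "r < n * n" "r div n = i" "r mod n = j" using ij by (auto simp: r_def)
    have "degree p \<le> n * n" by (rule degree_le) (simp add: coeff_p N_def)
    then have "pairing p (\<lambda>k. (A ^\<^sub>m k) $$ (i, j)) = (\<Sum>k\<le>n * n. coeff p k * (A ^\<^sub>m k) $$ (i, j))"
      by (rule pairing_eq_sum)
    also have "\<dots> = (\<Sum>k<N. R $$ (r, k) * v $ k)"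
      using r by (intro sum.cong) (auto simp: N_def coeff_p R_def)
    also have "\<dots> = (R *\<^sub>v v) $ r"
      using v(1) R r(1) by (simp add: scalar_prod_def lessThan_atLeast0 N_def)
    also have "\<dots> = 0" using v(3) r(1) by (simp add: N_def)
    finally show "pairing p (\<lambda>k. (A ^\<^sub>m k) $$ (i, j)) = 0" .
  qed
  ultimately show ?thesis by blast
qed

text \<open>
  Without the existence of a nonzero annihilating polynomial, the definite description that defines
  the minimal polynomial would be unspecified.
\<close>
lemma minimal_poly_props:
  assumes A: "(A :: 'a :: field mat) \<in> carrier_mat n n"
  shows "lead_coeff (minimal_poly A) = 1"
    and "annihilates (minimal_poly A) A"
    and "q \<noteq> 0 \<Longrightarrow> annihilates q A \<Longrightarrow> degree (minimal_poly A) \<le> degree q"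
proof -
  let ?S = "\<lambda>p. p \<noteq> 0 \<and> annihilates p A"
  let ?P = "\<lambda>p. lead_coeff p = 1 \<and> annihilates p A \<and> (\<forall>q. ?S q \<longrightarrow> degree p \<le> degree q)"
  from ex_annihilating_poly[OF A] obtain p where p: "?S p" and le: "\<And>q. ?S q \<Longrightarrow> degree p \<le> degree q"
    using ex_has_least_nat[of ?S _ degree] by blast
  define M where "M = smult (inverse (lead_coeff p)) p"
  have M: "?P M"
    using p le by (auto simp: M_def annihilates_smult[OF A])
  \<comment> \<open>The difference of two monic candidates annihilates and has smaller degree.\<close>
  have uniq: "q = M" if q: "?P q" for q
  proof (rule ccontr)
    assume "q \<noteq> M"
    define d where "d = q + smult (- 1) M"
    have d0: "d \<noteq> 0" using \<open>q \<noteq> M\<close> by (simp add: d_def)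
    have "annihilates d A"
      unfolding d_def using q M by (intro annihilates_add[OF A] annihilates_smult[OF A]) auto
    with d0 have "degree q \<le> degree d" using q by blast
    moreover have deg: "degree q = degree M"
      using q M by (metis le_antisym leading_coeff_0_iff zero_neq_one)
    moreover have "coeff d (degree q) = 0"
      using q M deg by (simp add: d_def)
    moreover have "degree d \<le> degree q"
      by (simp add: d_def degree_diff_le deg)
    ultimately have "lead_coeff d = 0" by (metis le_antisym)
    then show False using d0 by simp
  qed
  have "?P (minimal_poly A)"
    unfolding minimal_poly_def by (rule theI[of ?P, OF M uniq])
  then show "lead_coeff (minimal_poly A) = 1" "annihilates (minimal_poly A) A"
    "q \<noteq> 0 \<Longrightarrow> annihilates q A \<Longrightarrow> degree (minimal_poly A) \<le> degree q" by auto
qed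

lemma annihilates_iff_dvd:
  assumes A: "(A :: 'a :: field mat) \<in> carrier_mat n n"
  shows "annihilates q A \<longleftrightarrow> minimal_poly A dvd q"
proof
  assume "minimal_poly A dvd q"
  then show "annihilates q A"
    using annihilates_mult[OF A minimal_poly_props(2)[OF A]] by (metis dvd_def mult.commute)
next
  assume q: "annihilates q A"
  let ?M = "minimal_poly A"
  have M0: "?M \<noteq> 0" using minimal_poly_props(1)[OF A] by auto
  have "q mod ?M = q + - (q div ?M) * ?M"
    by (simp add: minus_div_mult_eq_mod[symmetric])
  then have "annihilates (q mod ?M) A"
    using annihilates_add[OF A q annihilates_mult[OF A minimal_poly_props(2)[OF A]]] by metis
  then have "q mod ?M = 0"
    using minimal_poly_props(3)[OF A] degree_mod_less[OF M0, of q]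
    by (meson not_le)
  then show "?M dvd q" by auto
qed

section \<open>Minimal polynomials under field extension\<close>

lemma ex_linear_functional_to_base_field:
  obtains \<phi> :: "'a :: field alg_closure \<Rightarrow> 'a" where "\<phi> 1 = 1"
    and "\<And>x y. \<phi> (x + y) = \<phi> x + \<phi> y" and "\<And>c x. \<phi> (to_ac c * x) = c * \<phi> x"
proof -
  let ?s = "\<lambda>(c :: 'a) (x :: 'a alg_closure). to_ac c * x"
  interpret vector_space_pair ?s "(*) :: 'a \<Rightarrow> 'a \<Rightarrow> 'a"
    by unfold_locales (auto simp: algebra_simps)
  have "vs1.independent {1}"
    by (simp add: vs1.dependent_single)
  from linear_independent_extend[OF this, of "\<lambda>_. 1"] obtain \<phi>
    where lin: "Vector_Spaces.linear ?s (*) \<phi>" and "\<phi> 1 = 1" by auto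
  interpret Vector_Spaces.linear ?s "(*)" \<phi> by (rule lin)
  show ?thesis using that[of \<phi>] \<open>\<phi> 1 = 1\<close> add scale by auto
qed

interpretation to_ac: field_hom to_ac
  by unfold_locales auto

interpretation to_ac_poly: map_poly_inj_idom_hom to_ac ..

text \<open>
  The minimal polynomial over the closure divides the one over the base field, so only the degrees
  are at stake. A linear functional \<open>\<phi>\<close> to the base field with \<open>\<phi>(1) = 1\<close>, applied to the coefficients of
  an annihilating polynomial over the closure, gives an annihilating polynomial over the base field
  since the powers of \<open>A\<close> have entries there. The degree does not grow, and a monic polynomial does not
  become zero in this way.
\<close>
lemma minimal_poly_to_ac:
  assumes A: "A \<in> carrier_mat n n"
  shows "minimal_poly (map_mat to_ac A) = map_poly to_ac (minimal_poly A)"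
proof -
  let ?B = "map_mat to_ac A" and ?M = "minimal_poly A"
  let ?N = "minimal_poly ?B"
  have B: "?B \<in> carrier_mat n n" using A by simp
  have pow: "(?B ^\<^sub>m k) $$ (i, j) = to_ac ((A ^\<^sub>m k) $$ (i, j))" if "i < n" "j < n" for i j k
    using that A by (simp add: to_ac.mat_hom_pow[OF A, symmetric])
  have pair: "pairing (map_poly to_ac p) (\<lambda>k. to_ac (a k)) = to_ac (pairing p a)" for p and a :: "nat \<Rightarrow> 'a"
    by (simp add: pairing_def to_ac_sum)
  have "annihilates (map_poly to_ac ?M) ?B"
    using minimal_poly_props(2)[OF A]
    by (simp add: annihilates_iff_pairing[OF A] annihilates_iff_pairing[OF B] pow pair)
  then have dvd: "?N dvd map_poly to_ac ?M" using annihilates_iff_dvd[OF B] by blast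
  have N: "lead_coeff ?N = 1" by (rule minimal_poly_props(1)[OF B])
  have M: "lead_coeff (map_poly to_ac ?M) = 1"
    using minimal_poly_props(1)[OF A] by simp
  obtain \<phi> :: "'a alg_closure \<Rightarrow> 'a" where \<phi>: "\<phi> 1 = 1"
    "\<And>x y. \<phi> (x + y) = \<phi> x + \<phi> y" "\<And>c x. \<phi> (to_ac c * x) = c * \<phi> x"
    using ex_linear_functional_to_base_field by blast
  have \<phi>0: "\<phi> 0 = 0" using \<phi>(3)[of 0 0] by simp
  have \<phi>_sum: "\<phi> (sum f S) = (\<Sum>x\<in>S. \<phi> (f x))" for f :: "nat \<Rightarrow> _" and S
    by (induction S rule: infinite_finite_induct) (auto simp: \<phi> \<phi>0)
  define p where "p = map_poly \<phi> ?N"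
  have deg_p: "degree p \<le> degree ?N"
    unfolding p_def by (rule degree_map_poly_le)
  have "p \<noteq> 0"
  proof
    assume "p = 0"
    then have "coeff p (degree ?N) = 0" by simp
    then show False using N by (simp add: p_def coeff_map_poly \<phi>0 \<phi>(1))
  qed
  moreover have "annihilates p A"
    unfolding annihilates_iff_pairing[OF A]
  proof (intro allI impI)
    fix i j assume ij: "i < n" "j < n"
    have "pairing p (\<lambda>k. (A ^\<^sub>m k) $$ (i, j)) = (\<Sum>k\<le>degree ?N. coeff p k * (A ^\<^sub>m k) $$ (i, j))"
      by (rule pairing_eq_sum[OF deg_p])
    also have "\<dots> = \<phi> (pairing ?N (\<lambda>k. (?B ^\<^sub>m k) $$ (i, j)))"
      by (simp add: pairing_def \<phi>_sum p_def coeff_map_poly \<phi>0 pow ij \<phi>(3) mult.commute[of _ "to_ac _"]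
          mult.commute[of "\<phi> _"])
    also have "pairing ?N (\<lambda>k. (?B ^\<^sub>m k) $$ (i, j)) = 0"
      using minimal_poly_props(2)[OF B] ij unfolding annihilates_iff_pairing[OF B] by blast
    finally show "pairing p (\<lambda>k. (A ^\<^sub>m k) $$ (i, j)) = 0" by (simp add: \<phi>0)
  qed
  ultimately have "degree ?M \<le> degree p" by (rule minimal_poly_props(3)[OF A])
  then have "degree (map_poly to_ac ?M) \<le> degree ?N" using deg_p by simp
  moreover have "degree ?N \<le> degree (map_poly to_ac ?M)"
    using dvd M by (intro dvd_imp_degree_le) auto
  ultimately have deg: "degree (map_poly to_ac ?M) = degree ?N" by simp
  from dvd obtain r where r: "map_poly to_ac ?M = ?N * r" ..
  have "?N \<noteq> 0" "r \<noteq> 0" using r M by auto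
  then have "degree r = 0" using r deg by (simp add: degree_mult_eq)
  then obtain c where "r = [:c:]" by (rule degree_eq_zeroE)
  moreover have "lead_coeff r = 1" using r M N by (metis lead_coeff_mult mult_1)
  ultimately show ?thesis using r by (simp add: one_pCons)
qed

section \<open>Powers of Kronecker products\<close>

lemma kronecker_carrier:
  assumes "A \<in> carrier_mat n n" "B \<in> carrier_mat m m"
  shows "kronecker A B \<in> carrier_mat (n * m) (n * m)"
  using assms by (simp add: kronecker_def)

lemma kronecker_index_less:
  assumes "i < n" "k < (m :: nat)"
  shows "i * m + k < n * m"
proof -
  have "i * m + k < Suc i * m" using assms by simp
  also have "\<dots> \<le> n * m" using assms by (intro mult_le_mono1) auto
  finally show ?thesis .
qed

lemma index_kronecker:
  assumes A: "A \<in> carrier_mat n n" and B: "B \<in> carrier_mat m m"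
    and "i < n" "j < n" "k < m" "l < m"
  shows "kronecker A B $$ (i * m + k, j * m + l) = A $$ (i, j) * B $$ (k, l)"
proof -
  show ?thesis
    using assms kronecker_index_less[of i n k m] kronecker_index_less[of j n l m]
    by (simp add: kronecker_def)
qed

lemma ex_kronecker_index:
  assumes "r < n * m"
  obtains i k where "i < n" "k < (m :: nat)" "r = i * m + k"
proof (rule that[of "r div m" "r mod m"])
  have "m > 0" using assms by (cases m) auto
  then show "r mod m < m" by simp
  show "r div m < n" using assms by (simp add: less_mult_imp_div_less)
qed simp

lemma sum_kronecker_index:
  "(\<Sum>r<n * m. f r) = (\<Sum>i<n. \<Sum>k<m. f (i * m + k))" for f :: "nat \<Rightarrow> 'b :: comm_monoid_add"
proof -
  have "sum f {i * m..<i * m + m} = (\<Sum>k<m. f (i * m + k))" for i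
    using sum.shift_bounds_nat_ivl[of f 0 "i * m" m]
    by (simp add: lessThan_atLeast0 add.commute)
  then show ?thesis by (simp add: sum.nat_group[symmetric])
qed

lemma kronecker_mult:
  fixes A B C D :: "'a :: comm_ring_1 mat"
  assumes A: "A \<in> carrier_mat n n" and C: "C \<in> carrier_mat n n"
    and B: "B \<in> carrier_mat m m" and D: "D \<in> carrier_mat m m"
  shows "kronecker A B * kronecker C D = kronecker (A * C) (B * D)" (is "?L = ?R")
proof (rule eq_matI)
  have car: "kronecker A B \<in> carrier_mat (n * m) (n * m)" "kronecker C D \<in> carrier_mat (n * m) (n * m)"
    "?R \<in> carrier_mat (n * m) (n * m)"
    using assms by (auto intro!: kronecker_carrier)
  then show "dim_row ?L = dim_row ?R" "dim_col ?L = dim_col ?R" by auto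
  fix r s assume "r < dim_row ?R" "s < dim_col ?R"
  then have rs: "r < n * m" "s < n * m" using car by auto
  then obtain i k j l where ik: "i < n" "k < m" "r = i * m + k" and jl: "j < n" "l < m" "s = j * m + l"
    by (metis ex_kronecker_index)
  have "?L $$ (r, s) = (\<Sum>u<n * m. kronecker A B $$ (r, u) * kronecker C D $$ (u, s))"
    using car rs by (simp add: scalar_prod_def lessThan_atLeast0)
  also have "\<dots> = (\<Sum>x<n. \<Sum>y<m. (A $$ (i, x) * C $$ (x, j)) * (B $$ (k, y) * D $$ (y, l)))"
    unfolding sum_kronecker_index
    by (intro sum.cong refl)
      (simp add: ik jl index_kronecker[OF A B] index_kronecker[OF C D] mult_ac)
  also have "\<dots> = (A * C) $$ (i, j) * (B * D) $$ (k, l)"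
    using assms ik jl
    by (simp add: scalar_prod_def lessThan_atLeast0 sum_product)
  also have "\<dots> = ?R $$ (r, s)"
    using assms ik jl by (simp add: index_kronecker[of _ n _ m])
  finally show "?L $$ (r, s) = ?R $$ (r, s)" .
qed

lemma kronecker_one: "kronecker (1\<^sub>m n) (1\<^sub>m m) = (1\<^sub>m (n * m) :: 'a :: comm_ring_1 mat)" (is "?L = ?R")
proof (rule eq_matI)
  show "dim_row ?L = dim_row ?R" "dim_col ?L = dim_col ?R" by (auto simp: kronecker_def)
  fix r s assume "r < dim_row ?R" "s < dim_col ?R"
  then have rs: "r < n * m" "s < n * m" by auto
  then obtain i k j l where ik: "i < n" "k < m" "r = i * m + k" and jl: "j < n" "l < m" "s = j * m + l"
    by (metis ex_kronecker_index)
  have "(i * m + k) div m = i" "(i * m + k) mod m = k" if "k < m" for i k using that by auto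
  then have "r = s \<longleftrightarrow> i = j \<and> k = l" using ik jl by metis
  moreover have "?L $$ (r, s) = 1\<^sub>m n $$ (i, j) * 1\<^sub>m m $$ (k, l)"
    using ik jl by (simp add: index_kronecker[of _ n _ m] del: index_one_mat)
  ultimately show "?L $$ (r, s) = ?R $$ (r, s)" using ik jl rs by simp
qed

lemma kronecker_pow:
  fixes A B :: "'a :: comm_ring_1 mat"
  assumes A: "A \<in> carrier_mat n n" and B: "B \<in> carrier_mat m m"
  shows "kronecker A B ^\<^sub>m k = kronecker (A ^\<^sub>m k) (B ^\<^sub>m k)"
proof (induction k)
  case 0
  have "dim_row (kronecker A B) = n * m" using kronecker_carrier[OF A B] by simp
  then show ?case using A B by (simp add: kronecker_one)
next
  case (Suc k)
  then show ?case using kronecker_mult[OF pow_carrier_mat[OF A] A pow_carrier_mat[OF B] B] by simp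
qed

lemma annihilates_kronecker_iff_pairing:
  fixes A B :: "'a :: comm_ring_1 mat"
  assumes A: "A \<in> carrier_mat n n" and B: "B \<in> carrier_mat m m"
  shows "annihilates p (kronecker A B) \<longleftrightarrow> (\<forall>i<n. \<forall>j<n. \<forall>k<m. \<forall>l<m.
    pairing p (\<lambda>e. (A ^\<^sub>m e) $$ (i, j) * (B ^\<^sub>m e) $$ (k, l)) = 0)" (is "?L \<longleftrightarrow> ?R")
proof -
  have entry: "(kronecker A B ^\<^sub>m e) $$ (i * m + k, j * m + l) = (A ^\<^sub>m e) $$ (i, j) * (B ^\<^sub>m e) $$ (k, l)"
    if "i < n" "j < n" "k < m" "l < m" for i j k l e
    using that A B by (simp add: kronecker_pow[OF A B] index_kronecker[of _ n _ m])
  have L: "?L \<longleftrightarrow> (\<forall>r<n * m. \<forall>s<n * m. pairing p (\<lambda>e. (kronecker A B ^\<^sub>m e) $$ (r, s)) = 0)"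
    by (rule annihilates_iff_pairing[OF kronecker_carrier[OF A B]])
  show ?thesis
  proof
    assume ?L
    show ?R
    proof (intro allI impI)
      fix i j k l assume b: "i < n" "j < n" "k < m" "l < m"
      have "i * m + k < n * m" "j * m + l < n * m"
        using b by (auto intro: kronecker_index_less)
      then have "pairing p (\<lambda>e. (kronecker A B ^\<^sub>m e) $$ (i * m + k, j * m + l)) = 0"
        using \<open>?L\<close> L by blast
      then show "pairing p (\<lambda>e. (A ^\<^sub>m e) $$ (i, j) * (B ^\<^sub>m e) $$ (k, l)) = 0"
        by (simp only: entry[OF b])
    qed
  next
    assume R: ?R
    show ?L
      unfolding L
    proof (intro allI impI)
      fix r s assume "r < n * m" "s < n * m"
      then obtain i k j l where "i < n" "k < m" "r = i * m + k" "j < n" "l < m" "s = j * m + l"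
        by (metis ex_kronecker_index)
      then show "pairing p (\<lambda>e. (kronecker A B ^\<^sub>m e) $$ (r, s)) = 0"
        using R entry by simp
    qed
  qed
qed

section \<open>Products of sequences attached to roots\<close>

text \<open>
  Vandermonde's identity for \<open>k = (k - i) + i\<close>, after rewriting
  \<open>(k choose i + r) (i + r choose i) = (k choose i) (k - i choose r)\<close>.
\<close>
lemma choose_mult_choose:
  "(k choose i) * (k choose j) = (\<Sum>r\<le>j. (k choose (i + r)) * ((i + r) choose i) * (i choose (j - r)))"
proof (cases "i \<le> k")
  case True
  have *: "(k choose (i + r)) * ((i + r) choose i) = (k choose i) * ((k - i) choose r)" for r
  proof (cases "i + r \<le> k")
    case True
    then show ?thesis using choose_mult[of i "i + r" k] by simp
  qed (auto simp: binomial_eq_0)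
  have "(k choose j) = (\<Sum>r\<le>j. ((k - i) choose r) * (i choose (j - r)))"
    using vandermonde[of "k - i" i j] True by simp
  then show ?thesis by (simp add: * sum_distrib_left mult.assoc)
qed (simp add: binomial_eq_0)

text \<open>
  Terms with \<open>i + r < j\<close> vanish because \<open>i choose (j - r)\<close> does, so the truncated exponent \<open>i + r - j\<close> is
  harmless.
\<close>
lemma jordan_seq_mult:
  "jordan_seq x i k * jordan_seq y j k =
    (\<Sum>r\<le>j. (of_nat (((i + r) choose i) * (i choose (j - r))) * x ^ r * y ^ (i + r - j))
       * jordan_seq (x * y) (i + r) k)"
proof -
  have "jordan_seq x i k * jordan_seq y j k = of_nat ((k choose i) * (k choose j)) * (x ^ (k - i) * y ^ (k - j))"
    by (simp add: jordan_seq_def mult_ac)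
  also have "\<dots> = (\<Sum>r\<le>j. of_nat ((k choose (i + r)) * ((i + r) choose i) * (i choose (j - r)))
      * (x ^ (k - i) * y ^ (k - j)))"
    unfolding choose_mult_choose by (simp only: of_nat_sum sum_distrib_right)
  also have "\<dots> = (\<Sum>r\<le>j. (of_nat (((i + r) choose i) * (i choose (j - r))) * x ^ r * y ^ (i + r - j))
       * jordan_seq (x * y) (i + r) k)"
  proof (intro sum.cong refl)
    fix r assume r: "r \<in> {..j}"
    show "of_nat ((k choose (i + r)) * ((i + r) choose i) * (i choose (j - r))) * (x ^ (k - i) * y ^ (k - j))
      = (of_nat (((i + r) choose i) * (i choose (j - r))) * x ^ r * y ^ (i + r - j))
         * jordan_seq (x * y) (i + r) k"
    proof (cases "i + r \<le> k \<and> j - r \<le> i")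
      case True
      then have "x ^ (k - i) = x ^ r * x ^ (k - (i + r))"
        by (simp add: power_add[symmetric])
      moreover have "y ^ (k - j) = y ^ (i + r - j) * y ^ (k - (i + r))"
      proof -
        have "k - j = (i + r - j) + (k - (i + r))" using True r by auto
        then show ?thesis by (metis power_add)
      qed
      ultimately show ?thesis by (simp add: jordan_seq_def power_mult_distrib mult_ac)
    next
      case False
      then have "(k choose (i + r)) * (i choose (j - r)) = 0" by (auto simp: binomial_eq_0)
      then have "(k choose (i + r)) = 0 \<or> (i choose (j - r)) = 0" by simp
      then show ?thesis by (auto simp: jordan_seq_def simp del: binomial_eq_0_iff)
    qed
  qed
  finally show ?thesis .
qed

context
  fixes F :: "'a :: field itself"
begin

lemma finite_wedge_set:
  "finite {i + j + 1 | i j. i \<le> s - 1 \<and> j \<le> t - 1 \<and> of_nat ((i + j) choose i) \<noteq> (0 :: 'a)}"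
  by (rule finite_subset[of _ "{..s + t + 1}"]) auto

lemma wedge_ge:
  assumes "i < s" "j < t" "of_nat ((i + j) choose i) \<noteq> (0 :: 'a)"
  shows "i + j < wedge F s t"
proof -
  have "i + j + 1 \<le> Max {i + j + 1 | i j. i \<le> s - 1 \<and> j \<le> t - 1 \<and> of_nat ((i + j) choose i) \<noteq> (0 :: 'a)}"
    using assms by (intro Max_ge finite_wedge_set CollectI exI[of _ i] exI[of _ j]) auto
  then show ?thesis using assms by (simp add: wedge_def)
qed

lemma wedge_pos: "s > 0 \<Longrightarrow> t > 0 \<Longrightarrow> wedge F s t > 0"
  using wedge_ge[of 0 s 0 t] by simp

lemma wedge_0 [simp]: "wedge F 0 t = 0" "wedge F s 0 = 0"
  by (simp_all add: wedge_def)

text \<open>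
  The maximum defining \<open>s \<and> t\<close> hides that every smaller value of \<open>i + j\<close> is also attained with a nonzero
  binomial coefficient: from a nonzero one in Pascal's triangle, one can descend row by row through
  nonzero ones, never increasing \<open>i\<close> or \<open>j\<close>.
\<close>
lemma less_wedgeE:
  assumes "n < wedge F s t"
  obtains i j where "i < s" "j < t" "i + j = n" "of_nat ((i + j) choose i) \<noteq> (0 :: 'a)"
proof -
  have pos: "s > 0" "t > 0" using assms by (auto simp: wedge_def split: if_splits)
  let ?S = "{i + j + 1 | i j. i \<le> s - 1 \<and> j \<le> t - 1 \<and> of_nat ((i + j) choose i) \<noteq> (0 :: 'a)}"
  have "0 + 0 + 1 \<in> ?S" by (rule CollectI, rule exI[of _ 0], rule exI[of _ 0]) simp
  then have "?S \<noteq> {}" by blast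
  then have "Max ?S \<in> ?S" by (intro Max_in finite_wedge_set)
  moreover have "wedge F s t = Max ?S" using pos by (simp add: wedge_def)
  ultimately obtain i0 j0 where ij: "i0 < s" "j0 < t" "of_nat ((i0 + j0) choose i0) \<noteq> (0 :: 'a)"
    and w: "wedge F s t = i0 + j0 + 1"
    using pos by (smt (verit) Suc_pred' less_Suc_eq_le mem_Collect_eq)
  have "\<exists>i j. i < s \<and> j < t \<and> i + j = n \<and> of_nat ((i + j) choose i) \<noteq> (0 :: 'a)"
    if "n \<le> i + j" "i < s" "j < t" "of_nat ((i + j) choose i) \<noteq> (0 :: 'a)" for i j
    using that
  proof (induction "i + j" arbitrary: i j)
    case 0
    then show ?case by (intro exI[of _ 0]) auto
  next
    case (Suc N)
    show ?case
    proof (cases "n = Suc N")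
      case True
      then show ?thesis using Suc by metis
    next
      case False
      \<comment> \<open>It suffices to reach the preceding row of Pascal's triangle.\<close>
      have down: "\<exists>i' j'. i' + j' = N \<and> i' < s \<and> j' < t \<and> of_nat ((i' + j') choose i') \<noteq> (0 :: 'a)"
      proof (cases i)
        case 0
        then show ?thesis using Suc by (intro exI[of _ 0] exI[of _ N]) auto
      next
        case i: (Suc i')
        show ?thesis
        proof (cases j)
          case 0
          then show ?thesis using Suc by (intro exI[of _ N] exI[of _ 0]) auto
        next
          case j: (Suc j')
          \<comment> \<open>Pascal's rule: one of the two neighbours below must be nonzero as well.\<close>
          have "(i + j) choose i = ((i' + j) choose i') + ((i + j') choose i)"
            using i j by simp
          then have "of_nat ((i' + j) choose i') \<noteq> (0 :: 'a) \<or> of_nat ((i + j') choose i) \<noteq> (0 :: 'a)"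
            using Suc.prems(4) by (metis add.right_neutral of_nat_add)
          then show ?thesis
          proof
            assume "of_nat ((i' + j) choose i') \<noteq> (0 :: 'a)"
            then show ?thesis using Suc i by (intro exI[of _ i'] exI[of _ j]) auto
          next
            assume "of_nat ((i + j') choose i) \<noteq> (0 :: 'a)"
            then show ?thesis using Suc j by (intro exI[of _ i] exI[of _ j']) auto
          qed
        qed
      qed
      then obtain i' j' where "i' + j' = N" "i' < s" "j' < t" "of_nat ((i' + j') choose i') \<noteq> (0 :: 'a)"
        by blast
      moreover have "n \<le> N" using Suc.prems(1) Suc.hyps(2) False by simp
      ultimately show ?thesis using Suc.hyps(1)[of i' j'] by blast
    qed
  qed
  moreover have "n \<le> i0 + j0" using assms w by simp
  ultimately have "\<exists>i j. i < s \<and> j < t \<and> i + j = n \<and> of_nat ((i + j) choose i) \<noteq> (0 :: 'a)"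
    using ij by blast
  with that show ?thesis by blast
qed

lemma wedge_mono:
  assumes "s \<le> s'" "t \<le> t'"
  shows "wedge F s t \<le> wedge F s' t'"
proof (cases "wedge F s t")
  case (Suc n)
  then have "n < wedge F s t" by simp
  then obtain i j where "i < s" "j < t" "i + j = n" "of_nat ((i + j) choose i) \<noteq> (0 :: 'a)"
    by (rule less_wedgeE)
  then show ?thesis using wedge_ge[of i s' j t'] assms Suc by auto
qed simp

text \<open>
  Let \<open>h n\<close> be the Taylor coefficients of \<open>p\<close> at \<open>x y\<close>. The conditions on the left are linear equations in
  them. Only the \<open>h n\<close> with \<open>n < s \<and> t\<close> occur with a nonzero coefficient, which gives one direction. For
  the other, these \<open>h n\<close> are shown to vanish one after the other: \<open>h n\<close> is the last term in the equation
  for a pair \<open>i + j = n\<close> with \<open>(i + j choose i) \<noteq> 0\<close>, and the terms before it are already known to vanish.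
\<close>
lemma pairing_jordan_mult_iff_wedge:
  assumes "x \<noteq> 0" "y \<noteq> (0 :: 'a)"
  shows "(\<forall>i<s. \<forall>j<t. pairing p (\<lambda>k. jordan_seq x i k * jordan_seq y j k) = 0)
    \<longleftrightarrow> [:- (x * y), 1:] ^ wedge F s t dvd p"
proof -
  define h where "h n = pairing p (jordan_seq (x * y) n)" for n
  define c where "c i j r = of_nat (((i + r) choose i) * (i choose (j - r))) * x ^ r * y ^ (i + r - j)" for i j r
  have expand: "pairing p (\<lambda>k. jordan_seq x i k * jordan_seq y j k) = (\<Sum>r\<le>j. c i j r * h (i + r))" for i j
    unfolding jordan_seq_mult c_def h_def by (rule pairing_sum_right)
  have "(\<forall>i<s. \<forall>j<t. (\<Sum>r\<le>j. c i j r * h (i + r)) = 0) \<longleftrightarrow> (\<forall>n<wedge F s t. h n = 0)"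
  proof (intro iffI allI impI)
    fix n assume *: "\<forall>i<s. \<forall>j<t. (\<Sum>r\<le>j. c i j r * h (i + r)) = 0" and "n < wedge F s t"
    then show "h n = 0"
    proof (induction n rule: less_induct)
      case (less n)
      from less.prems(2) obtain i j where ij: "i < s" "j < t" "i + j = n" "of_nat ((i + j) choose i) \<noteq> (0 :: 'a)"
        by (rule less_wedgeE)
      have "h (i + r) = 0" if "r < j" for r
        using that less ij by simp
      then have "(\<Sum>r\<le>j. c i j r * h (i + r)) = c i j j * h n"
        using ij(3) by (simp flip: lessThan_Suc_atMost)
      moreover have "c i j j \<noteq> 0" using assms ij(4) by (simp add: c_def)
      ultimately show ?case using * ij by simp
    qed
  next
    fix i j assume *: "\<forall>n<wedge F s t. h n = 0" and ij: "i < s" "j < t"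
    show "(\<Sum>r\<le>j. c i j r * h (i + r)) = 0"
    proof (intro sum.neutral ballI)
      fix r assume "r \<in> {..j}"
      then have "r < t" using ij by simp
      then show "c i j r * h (i + r) = 0"
        using wedge_ge[OF ij(1), of r t] * by (cases "of_nat ((i + r) choose i) = (0 :: 'a)") (auto simp: c_def)
    qed
  qed
  then show ?thesis by (simp add: expand root_power_dvd_iff_pairing h_def)
qed

end

text \<open>
  The multiplicity of \<open>x y\<close> in the minimal polynomial of the Kronecker product of two Jordan blocks with
  eigenvalues \<open>x\<close>, \<open>y\<close> and sizes \<open>s\<close>, \<open>t\<close>. It is 0 when a size is 0, that is, when \<open>x\<close> or \<open>y\<close> is
  no eigenvalue.
\<close>
definition block_order :: "'a :: field \<Rightarrow> nat \<Rightarrow> 'a \<Rightarrow> nat \<Rightarrow> nat" where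
  "block_order x s y t =
     (if s = 0 \<or> t = 0 then 0
      else if x \<noteq> 0 \<and> y \<noteq> 0 then wedge TYPE('a) s t
      else if x = 0 \<and> y = 0 then min s t
      else if x = 0 then s else t)"

lemma jordan_seq_0: "jordan_seq (0 :: 'a :: comm_ring_1) i k = (if k = i then 1 else 0)"
proof (cases k i rule: linorder_cases)
  case greater
  then have "k - i \<noteq> 0" by simp
  then show ?thesis using greater by (simp add: jordan_seq_def power_0_left)
qed (simp_all add: jordan_seq_def binomial_eq_0)

lemma pairing_jordan_seq_0: "pairing p (\<lambda>k. jordan_seq 0 i k * a k) = coeff p i * a i"
proof -
  have "pairing p (\<lambda>k. jordan_seq 0 i k * a k) = (\<Sum>k\<le>max (degree p) i. coeff p k * (jordan_seq 0 i k * a k))"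
    by (rule pairing_eq_sum) simp
  also have "\<dots> = (\<Sum>k\<le>max (degree p) i. if k = i then coeff p k * a k else 0)"
    by (intro sum.cong) (auto simp: jordan_seq_0)
  finally show ?thesis by simp
qed

text \<open>
  At the eigenvalue 0 the sequences are unit vectors, so that the pairing picks out the coefficient \<open>p\<^sub>i\<close>.
  The condition for \<open>j = 0\<close> already forces \<open>p\<^sub>i = 0\<close>.
\<close>
lemma pairing_jordan_0_iff:
  assumes "y \<noteq> 0" "t > 0"
  shows "(\<forall>i<s. \<forall>j<t. pairing p (\<lambda>k. jordan_seq 0 i k * jordan_seq y j k) = 0)
    \<longleftrightarrow> [:0, 1:] ^ s dvd (p :: 'a :: field poly)" (is "?L \<longleftrightarrow> _")
proof -
  have "?L \<longleftrightarrow> (\<forall>i<s. coeff p i = 0)"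
  proof
    assume L: ?L
    show "\<forall>i<s. coeff p i = 0"
    proof (intro allI impI)
      fix i assume "i < s"
      then have "coeff p i * jordan_seq y 0 i = 0"
        using L assms(2) unfolding pairing_jordan_seq_0 by blast
      then show "coeff p i = 0" using assms(1) by (simp add: jordan_seq_def)
    qed
  qed (simp add: pairing_jordan_seq_0)
  also have "\<dots> \<longleftrightarrow> [:0, 1:] ^ s dvd p"
    using monom_1_dvd_iff'[of s p] by (simp add: monom_altdef)
  finally show ?thesis .
qed

lemma pairing_jordan_mult_iff:
  "(\<forall>i<s. \<forall>j<t. pairing p (\<lambda>k. jordan_seq x i k * jordan_seq y j k) = 0)
    \<longleftrightarrow> [:- (x * y), 1:] ^ block_order x s y t dvd (p :: 'a :: field poly)" (is "?L \<longleftrightarrow> ?R")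
proof (cases "s = 0 \<or> t = 0")
  case True
  then show ?thesis by (auto simp: block_order_def)
next
  case False
  then have st: "s > 0" "t > 0" by auto
  consider "x \<noteq> 0" "y \<noteq> 0" | "x = 0" "y = 0" | "x = 0" "y \<noteq> 0" | "x \<noteq> 0" "y = 0" by blast
  then show ?thesis
  proof cases
    case 1
    then show ?thesis
      using st pairing_jordan_mult_iff_wedge[OF 1, of s t p] by (simp add: block_order_def)
  next
    case 2
    have "?L \<longleftrightarrow> (\<forall>i<min s t. coeff p i = 0)"
      unfolding 2 pairing_jordan_seq_0 by (auto simp: jordan_seq_0)
    also have "\<dots> \<longleftrightarrow> [:0, 1:] ^ min s t dvd p"
      using monom_1_dvd_iff'[of "min s t" p] by (simp add: monom_altdef)
    finally show ?thesis using 2 st by (simp add: block_order_def)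
  next
    case 3
    then show ?thesis using st pairing_jordan_0_iff[of y t s p] by (simp add: block_order_def)
  next
    case 4
    have "?L \<longleftrightarrow> (\<forall>j<t. \<forall>i<s. pairing p (\<lambda>k. jordan_seq y j k * jordan_seq x i k) = 0)"
      by (auto simp: mult.commute)
    then show ?thesis using 4 st pairing_jordan_0_iff[of x s t p] by (simp add: block_order_def)
  qed
qed

section \<open>The minimal polynomial of a Kronecker product of two matrices\<close>

lemma dvd_iff_order_powers:
  fixes p q :: "'a :: alg_closed_field poly"
  assumes "p \<noteq> 0"
  shows "p dvd q \<longleftrightarrow> (\<forall>x. [:- x, 1:] ^ order x p dvd q)"
proof
  assume "p dvd q"
  then show "\<forall>x. [:- x, 1:] ^ order x p dvd q" using order_1 dvd_trans by blast
next
  assume "\<forall>x. [:- x, 1:] ^ order x p dvd q"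
  then show "p dvd q"
    using assms
  proof (induction p arbitrary: q rule: poly_root_order_induct)
    case 0
    then show ?case by simp
  next
    case (no_roots p)
    then have "degree p = 0" using alg_closed_imp_poly_has_root[of p] by auto
    then have "is_unit p" using no_roots by (simp add: is_unit_iff_degree)
    then show ?case by (rule unit_imp_dvd)
  next
    case (root p x n)
    have p: "p \<noteq> 0" using root by auto
    have ord: "order y ([:- x, 1:] ^ n * p) = (if y = x then n else order y p)" for y
      using root p by (subst order_mult) (auto simp: order_power_n_n order_0I)
    from root.prems(1) have "[:- x, 1:] ^ n dvd q" using ord[of x] by metis
    then obtain r where r: "q = [:- x, 1:] ^ n * r" ..
    have "p dvd r"
    proof (cases "r = 0")
      case False
      have "[:- y, 1:] ^ order y p dvd r" for y
      proof (cases "y = x")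
        case True
        then show ?thesis using root by (simp add: order_0I)
      next
        case False
        have "[:- y, 1:] ^ order y p dvd q"
          using root.prems(1) ord[of y] False by metis
        moreover have "order y q = order y r"
          using r \<open>r \<noteq> 0\<close> False by (simp add: order_mult order_0I)
        ultimately show ?thesis using r \<open>r \<noteq> 0\<close> by (simp add: order_divides)
      qed
      then show ?thesis using root.IH p by blast
    qed simp
    then show ?case using r by simp
  qed
qed

lemma annihilates_iff_jordan_seq:
  fixes A :: "'a :: alg_closed_field mat"
  assumes A: "A \<in> carrier_mat n n"
  shows "annihilates q A \<longleftrightarrow> (\<forall>x. \<forall>i<order x (minimal_poly A). pairing q (jordan_seq x i) = 0)"
proof -
  have "minimal_poly A \<noteq> 0" using minimal_poly_props(1)[OF A] by auto
  then show ?thesis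
    by (simp add: annihilates_iff_dvd[OF A] dvd_iff_order_powers root_power_dvd_iff_pairing)
qed

text \<open>
  The quantifier over the entries of \<open>A\<close> is first replaced by one over the roots for \<open>A\<close>, while the entries
  of \<open>B\<close> are fixed; then the roles are exchanged.
\<close>
lemma annihilates_kronecker_iff:
  fixes A B :: "'a :: alg_closed_field mat"
  assumes A: "A \<in> carrier_mat n n" and B: "B \<in> carrier_mat m m"
  shows "annihilates p (kronecker A B) \<longleftrightarrow> (\<forall>x y. [:- (x * y), 1:] ^
    block_order x (order x (minimal_poly A)) y (order y (minimal_poly B)) dvd p)"
proof -
  let ?a = "\<lambda>i j e. (A ^\<^sub>m e) $$ (i, j)" and ?b = "\<lambda>k l e. (B ^\<^sub>m e) $$ (k, l)"
  let ?oA = "\<lambda>x. order x (minimal_poly A)" and ?oB = "\<lambda>y. order y (minimal_poly B)"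
  have "annihilates p (kronecker A B) \<longleftrightarrow> (\<forall>k<m. \<forall>l<m. annihilates (scale_coeffs (?b k l) p) A)"
    unfolding annihilates_kronecker_iff_pairing[OF A B] annihilates_iff_pairing[OF A]
    by (auto simp: pairing_scale_coeffs mult.commute)
  also have "\<dots> \<longleftrightarrow> (\<forall>x. \<forall>i<?oA x. \<forall>k<m. \<forall>l<m. pairing p (\<lambda>e. ?b k l e * jordan_seq x i e) = 0)"
    unfolding annihilates_iff_jordan_seq[OF A] pairing_scale_coeffs by blast
  also have "\<dots> \<longleftrightarrow> (\<forall>x. \<forall>i<?oA x. annihilates (scale_coeffs (jordan_seq x i) p) B)"
    unfolding annihilates_iff_pairing[OF B] pairing_scale_coeffs by (simp add: mult.commute)
  also have "\<dots> \<longleftrightarrow> (\<forall>x y. \<forall>i<?oA x. \<forall>j<?oB y.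
      pairing p (\<lambda>e. jordan_seq x i e * jordan_seq y j e) = 0)"
    unfolding annihilates_iff_jordan_seq[OF B] pairing_scale_coeffs by blast
  finally show ?thesis by (simp add: pairing_jordan_mult_iff)
qed

lemma order_kronecker_ge:
  fixes A B :: "'a :: alg_closed_field mat"
  assumes A: "A \<in> carrier_mat n n" and B: "B \<in> carrier_mat m m"
  shows "block_order x (order x (minimal_poly A)) y (order y (minimal_poly B))
    \<le> order (x * y) (minimal_poly (kronecker A B))"
proof -
  note AB = kronecker_carrier[OF A B]
  have "minimal_poly (kronecker A B) \<noteq> 0" using minimal_poly_props(1)[OF AB] by auto
  then show ?thesis
    using minimal_poly_props(2)[OF AB] by (simp add: annihilates_kronecker_iff[OF A B] order_divides)
qed

text \<open>
  If no pair of roots contributed the full multiplicity of \<open>z\<close>, one factor \<open>X - z\<close> could be removed from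
  the minimal polynomial, and the quotient would still annihilate.
\<close>
lemma order_kronecker_attained:
  fixes A B :: "'a :: alg_closed_field mat"
  assumes A: "A \<in> carrier_mat n n" and B: "B \<in> carrier_mat m m"
    and pos: "order z (minimal_poly (kronecker A B)) > 0"
  shows "\<exists>x y. x * y = z \<and> block_order x (order x (minimal_poly A)) y (order y (minimal_poly B))
    = order z (minimal_poly (kronecker A B))"
proof (rule ccontr)
  let ?b = "\<lambda>x y. block_order x (order x (minimal_poly A)) y (order y (minimal_poly B))"
  let ?M = "minimal_poly (kronecker A B)"
  assume none: "\<not> (\<exists>x y. x * y = z \<and> ?b x y = order z ?M)"
  then have less: "?b x y < order z ?M" if "x * y = z" for x y
    using order_kronecker_ge[OF A B, of x y] that none by (metis le_neq_implies_less)
  note AB = kronecker_carrier[OF A B]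
  have M0: "?M \<noteq> 0" using minimal_poly_props(1)[OF AB] by auto
  then have "[:- z, 1:] dvd ?M" using pos by (simp add: order_gt_0_iff poly_eq_0_iff_dvd)
  then obtain q where q: "?M = [:- z, 1:] * q" ..
  then have q0: "q \<noteq> 0" using M0 by auto
  have ord: "order w ?M = (if w = z then 1 else 0) + order w q" for w
  proof -
    have "order w [:- z, 1:] = (if w = z then 1 else 0)"
      using order_power_n_n[of w 1] by (simp add: order_0I)
    moreover have "order w ?M = order w [:- z, 1:] + order w q"
      unfolding q using M0 q by (intro order_mult) metis
    ultimately show ?thesis by simp
  qed
  have "?b x y \<le> order (x * y) q" for x y
    using less[of x y] order_kronecker_ge[OF A B, of x y] ord[of "x * y"] by (cases "x * y = z") auto
  then have "annihilates q (kronecker A B)"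
    using q0 by (simp add: annihilates_kronecker_iff[OF A B] order_divides)
  then have "degree ?M \<le> degree q" using minimal_poly_props(3)[OF AB q0] by simp
  moreover have "degree ?M = Suc (degree q)"
    unfolding q using q0 by (subst degree_mult_eq) auto
  ultimately show False by simp
qed

section \<open>Nonzero eigenvalues of iterated Kronecker products\<close>

lemma kronecker_list_append:
  "As \<noteq> [] \<Longrightarrow> kronecker_list (As @ [B]) = kronecker (kronecker_list As) B"
  by (simp add: kronecker_list_def)

lemma wedges_append: "ts \<noteq> [] \<Longrightarrow> wedges F (ts @ [t]) = wedge F (wedges F ts) t"
  by (simp add: wedges_def)

lemma kronecker_list_square:
  assumes "As \<noteq> []" "\<forall>A\<in>set As. square_mat A"
  shows "square_mat (kronecker_list As)"
  using assms
proof (induction As rule: rev_induct)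
  case (snoc B As)
  show ?case
  proof (cases "As = []")
    case True
    then show ?thesis using snoc.prems by (simp add: kronecker_list_def)
  next
    case False
    then show ?thesis
      using snoc unfolding kronecker_list_append[OF False] by (simp add: kronecker_def)
  qed
qed simp

abbreviation minpoly_orders :: "'a :: field mat list \<Rightarrow> 'a list \<Rightarrow> nat list" where
  "minpoly_orders As xs \<equiv> map2 (\<lambda>A x. order x (minimal_poly A)) As xs"

lemma wedges_minpoly_orders_append:
  assumes "As \<noteq> []" "length xs = length As"
  shows "wedges F (minpoly_orders As xs @ [t]) = wedge F (wedges F (minpoly_orders As xs)) t"
  using assms by (intro wedges_append) (cases As; cases xs; simp)

lemma block_order_nonzero:
  fixes x y :: "'a :: field"
  shows "x \<noteq> 0 \<Longrightarrow> y \<noteq> 0 \<Longrightarrow> block_order x s y t = wedge TYPE('a) s t"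
  by (simp add: block_order_def)

lemma block_order_pos: "block_order x s y t > 0 \<Longrightarrow> s > 0 \<and> t > 0"
  unfolding block_order_def by (cases "s = 0"; cases "t = 0") simp_all

lemma square_mat_carrier: "square_mat A \<Longrightarrow> A \<in> carrier_mat (dim_row A) (dim_row A)"
  by (rule carrier_matI) auto

lemma wedges_le_order_kronecker_list:
  fixes As :: "'a :: alg_closed_field mat list"
  assumes "As \<noteq> []" "\<forall>A\<in>set As. square_mat A" "length xs = length As" "0 \<notin> set xs"
  shows "wedges TYPE('a) (minpoly_orders As xs) \<le> order (prod_list xs) (minimal_poly (kronecker_list As))"
  using assms
proof (induction As arbitrary: xs rule: rev_induct)
  case (snoc B As)
  from snoc.prems(3) have "xs \<noteq> []" by auto
  then obtain ys y where xs: "xs = ys @ [y]" by (metis rev_exhaust)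
  then have len: "length ys = length As" and nz: "0 \<notin> set ys" "y \<noteq> 0" using snoc.prems by auto
  show ?case
  proof (cases "As = []")
    case True
    then show ?thesis using xs len by (simp add: wedges_def kronecker_list_def)
  next
    case False
    let ?C = "kronecker_list As"
    have C: "?C \<in> carrier_mat (dim_row ?C) (dim_row ?C)" and B: "B \<in> carrier_mat (dim_row B) (dim_row B)"
      using kronecker_list_square[OF False] snoc.prems by (auto intro!: square_mat_carrier)
    have "wedges TYPE('a) (minpoly_orders (As @ [B]) xs)
        = wedge TYPE('a) (wedges TYPE('a) (minpoly_orders As ys)) (order y (minimal_poly B))"
      using len False by (simp add: xs wedges_minpoly_orders_append)
    also have "\<dots> \<le> wedge TYPE('a) (order (prod_list ys) (minimal_poly ?C)) (order y (minimal_poly B))"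
      using snoc.IH[OF False _ len nz(1)] snoc.prems by (intro wedge_mono) auto
    also have "\<dots> \<le> order (prod_list ys * y) (minimal_poly (kronecker ?C B))"
      using order_kronecker_ge[OF C B, of "prod_list ys" y] nz
      by (simp add: block_order_nonzero prod_list_zero_iff)
    finally show ?thesis using False by (simp add: xs kronecker_list_append)
  qed
qed simp

lemma order_kronecker_list_attained:
  fixes As :: "'a :: alg_closed_field mat list"
  assumes "As \<noteq> []" "\<forall>A\<in>set As. square_mat A" "z \<noteq> 0"
    and "order z (minimal_poly (kronecker_list As)) > 0"
  shows "\<exists>xs. length xs = length As \<and> 0 \<notin> set xs \<and> prod_list xs = z
    \<and> wedges TYPE('a) (minpoly_orders As xs) = order z (minimal_poly (kronecker_list As))"
  using assms
proof (induction As arbitrary: z rule: rev_induct)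
  case (snoc B As)
  show ?case
  proof (cases "As = []")
    case True
    then show ?thesis
      using snoc.prems by (intro exI[of _ "[z]"]) (simp add: wedges_def kronecker_list_def)
  next
    case False
    let ?C = "kronecker_list As"
    have C: "?C \<in> carrier_mat (dim_row ?C) (dim_row ?C)" and B: "B \<in> carrier_mat (dim_row B) (dim_row B)"
      using kronecker_list_square[OF False] snoc.prems by (auto intro!: square_mat_carrier)
    note app = kronecker_list_append[OF False, of B]
    from order_kronecker_attained[OF C B, of z] obtain x y where xy: "x * y = z"
      and b: "block_order x (order x (minimal_poly ?C)) y (order y (minimal_poly B))
        = order z (minimal_poly (kronecker ?C B))"
      using snoc.prems(4) app by auto
    have nz: "x \<noteq> 0" "y \<noteq> 0" using xy snoc.prems(3) by auto
    have "order x (minimal_poly ?C) > 0"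
      using b snoc.prems(4) app block_order_pos by metis
    then obtain ys where ys: "length ys = length As" "0 \<notin> set ys" "prod_list ys = x"
      "wedges TYPE('a) (minpoly_orders As ys) = order x (minimal_poly ?C)"
      using snoc.IH[OF False _ nz(1)] snoc.prems(2) by auto
    show ?thesis
      using ys xy nz b False app
      by (intro exI[of _ "ys @ [y]"]) (simp add: wedges_minpoly_orders_append block_order_nonzero)
  qed
qed simp

section \<open>The eigenvalue zero of iterated Kronecker products\<close>

definition no_nonzero_eigenvalue :: "'a :: field mat \<Rightarrow> bool" where
  "no_nonzero_eigenvalue A \<longleftrightarrow> (\<forall>x. x \<noteq> 0 \<longrightarrow> order x (minimal_poly A) = 0)"

abbreviation index_0 :: "'a :: field mat \<Rightarrow> nat" where
  "index_0 A \<equiv> order 0 (minimal_poly A)"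

lemma no_nonzero_eigenvalue_kronecker:
  fixes A B :: "'a :: alg_closed_field mat"
  assumes A: "A \<in> carrier_mat n n" and B: "B \<in> carrier_mat m m"
  shows "no_nonzero_eigenvalue (kronecker A B) \<longleftrightarrow> no_nonzero_eigenvalue A \<or> no_nonzero_eigenvalue B"
    (is "?L \<longleftrightarrow> ?R")
proof
  show "?L \<Longrightarrow> ?R"
  proof (rule ccontr)
    assume L: ?L and "\<not> ?R"
    then obtain x y where nz: "x \<noteq> 0" "y \<noteq> 0"
      and "order x (minimal_poly A) > 0" "order y (minimal_poly B) > 0"
      unfolding no_nonzero_eigenvalue_def de_Morgan_disj not_all not_imp neq0_conv by blast
    then have "block_order x (order x (minimal_poly A)) y (order y (minimal_poly B)) > 0"
      by (simp add: block_order_nonzero wedge_pos)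
    then have "order (x * y) (minimal_poly (kronecker A B)) > 0"
      using order_kronecker_ge[OF A B, of x y] by simp
    then show False using L nz by (simp add: no_nonzero_eigenvalue_def)
  qed
  show ?L if R: ?R
    unfolding no_nonzero_eigenvalue_def
  proof (intro allI impI, rule ccontr)
    fix z :: 'a assume "z \<noteq> 0" and "order z (minimal_poly (kronecker A B)) \<noteq> 0"
    then have z: "order z (minimal_poly (kronecker A B)) > 0" by (simp only: neq0_conv)
    from order_kronecker_attained[OF A B z] obtain x y where xy: "x * y = z"
      and "block_order x (order x (minimal_poly A)) y (order y (minimal_poly B))
        = order z (minimal_poly (kronecker A B))"
      by blast
    then have "order x (minimal_poly A) > 0 \<and> order y (minimal_poly B) > 0"
      using z block_order_pos by metis
    moreover have "x \<noteq> 0" "y \<noteq> 0" using xy \<open>z \<noteq> 0\<close> by auto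
    ultimately show False using R by (metis no_nonzero_eigenvalue_def less_irrefl)
  qed
qed

text \<open>
  The pairs with product 0 are \<open>(0, 0)\<close>, contributing the minimum, and the pairs with exactly one zero, where
  the nonzero eigenvalue of one matrix lets the other contribute its full multiplicity of 0.
\<close>
lemma index_0_kronecker:
  fixes A B :: "'a :: alg_closed_field mat"
  assumes A: "A \<in> carrier_mat n n" and B: "B \<in> carrier_mat m m"
  shows "index_0 (kronecker A B) =
    (if no_nonzero_eigenvalue A
     then if no_nonzero_eigenvalue B then min (index_0 A) (index_0 B) else index_0 A
     else if no_nonzero_eigenvalue B then index_0 B else max (index_0 A) (index_0 B))" (is "_ = ?r")
proof (rule antisym)
  let ?a = "\<lambda>x. order x (minimal_poly A)" and ?b = "\<lambda>y. order y (minimal_poly B)"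
  note ge = order_kronecker_ge[OF A B]
  have geA: "index_0 A \<le> index_0 (kronecker A B)" if "\<not> no_nonzero_eigenvalue B"
  proof -
    from that obtain y where y: "y \<noteq> 0" "?b y > 0"
      unfolding no_nonzero_eigenvalue_def not_all not_imp neq0_conv by blast
    then have "block_order 0 (?a 0) y (?b y) = ?a 0" by (simp add: block_order_def)
    then show ?thesis using ge[of 0 y] by simp
  qed
  have geB: "index_0 B \<le> index_0 (kronecker A B)" if "\<not> no_nonzero_eigenvalue A"
  proof -
    from that obtain x where x: "x \<noteq> 0" "?a x > 0"
      unfolding no_nonzero_eigenvalue_def not_all not_imp neq0_conv by blast
    then have "block_order x (?a x) 0 (?b 0) = ?b 0" by (simp add: block_order_def)
    then show ?thesis using ge[of x 0] by simp
  qed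
  have "min (index_0 A) (index_0 B) \<le> index_0 (kronecker A B)"
    using ge[of 0 0] by (cases "?a 0 = 0"; cases "?b 0 = 0") (simp_all add: block_order_def)
  with geA geB show "?r \<le> index_0 (kronecker A B)" by auto
  show "index_0 (kronecker A B) \<le> ?r"
  proof (cases "index_0 (kronecker A B) > 0")
    case True
    from order_kronecker_attained[OF A B True] obtain x y where xy: "x * y = 0"
      and b: "block_order x (?a x) y (?b y) = index_0 (kronecker A B)" by blast
    then have pos: "?a x > 0" "?b y > 0" using True block_order_pos by metis+
    then have nil: "no_nonzero_eigenvalue A \<Longrightarrow> x = 0" "no_nonzero_eigenvalue B \<Longrightarrow> y = 0"
      unfolding no_nonzero_eigenvalue_def by (metis less_irrefl)+
    show ?thesis
      using xy pos nil unfolding b[symmetric] block_order_def by auto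
  qed simp
qed

lemma index_0_kronecker_list:
  fixes As :: "'a :: alg_closed_field mat list"
  assumes "As \<noteq> []" "\<forall>A\<in>set As. square_mat A"
  defines "N \<equiv> \<lambda>As. {A \<in> set As. no_nonzero_eigenvalue A}"
  shows "(no_nonzero_eigenvalue (kronecker_list As) \<longleftrightarrow> N As \<noteq> {})
    \<and> index_0 (kronecker_list As) =
      (if N As \<noteq> {} then Min (index_0 ` N As) else Max (index_0 ` set As))"
  using assms(1,2)
proof (induction As rule: rev_induct)
  case (snoc B As)
  show ?case
  proof (cases "As = []")
    case True
    moreover have "N [B] = (if no_nonzero_eigenvalue B then {B} else {})"
      by (auto simp: N_def)
    ultimately show ?thesis by (simp add: kronecker_list_def)
  next
    case False
    let ?C = "kronecker_list As"
    have C: "?C \<in> carrier_mat (dim_row ?C) (dim_row ?C)" and B: "B \<in> carrier_mat (dim_row B) (dim_row B)"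
      using kronecker_list_square[OF False] snoc.prems by (auto intro!: square_mat_carrier)
    have N: "N (As @ [B]) = (if no_nonzero_eigenvalue B then insert B (N As) else N As)" "finite (N As)"
      by (auto simp: N_def)
    have IH: "no_nonzero_eigenvalue ?C \<longleftrightarrow> N As \<noteq> {}"
      "index_0 ?C = (if N As \<noteq> {} then Min (index_0 ` N As) else Max (index_0 ` set As))"
      using snoc.IH[OF False] snoc.prems(2) by simp_all
    have "Max (index_0 ` set (As @ [B])) = max (index_0 B) (Max (index_0 ` set As))"
      using False by simp
    moreover have "Min (index_0 ` insert B (N As)) = min (index_0 B) (Min (index_0 ` N As))" if "N As \<noteq> {}"
      using that N(2) by simp
    ultimately show ?thesis
      unfolding kronecker_list_append[OF False] no_nonzero_eigenvalue_kronecker[OF C B]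
        index_0_kronecker[OF C B] IH N(1)
      by (cases "no_nonzero_eigenvalue B"; cases "N As = {}")
        (simp_all only: if_True if_False not_True_eq_False not_False_eq_True simp_thms
          insert_not_empty image_insert image_empty Min_singleton max.commute min.commute)
  qed
qed simp

section \<open>The polynomial \<open>\<Upsilon>\<close> and the minimal polynomial\<close>

lemma wedge_alg_closure: "wedge TYPE('a :: field alg_closure) = wedge TYPE('a)"
proof -
  have "of_nat n = (0 :: 'a alg_closure) \<longleftrightarrow> of_nat n = (0 :: 'a)" for n
    unfolding to_ac_of_nat[symmetric] by (rule to_ac_eq_0_iff)
  then show ?thesis by (intro ext) (simp add: wedge_def)
qed

lemma map_mat_to_ac_kronecker:
  "map_mat to_ac (kronecker A B) = kronecker (map_mat to_ac A) (map_mat to_ac B)"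
proof (rule eq_matI)
  fix i j
  assume "i < dim_row (kronecker (map_mat to_ac A) (map_mat to_ac B))"
    "j < dim_col (kronecker (map_mat to_ac A) (map_mat to_ac B))"
  then have ij: "i < dim_row A * dim_row B" "j < dim_col A * dim_col B" by (auto simp: kronecker_def)
  then have "dim_row B > 0" "dim_col B > 0" by (metis gr0I mult_0_right not_less0)+
  then have "i mod dim_row B < dim_row B" "j mod dim_col B < dim_col B"
    "i div dim_row B < dim_row A" "j div dim_col B < dim_col A"
    using ij by (auto simp: less_mult_imp_div_less)
  then show "map_mat to_ac (kronecker A B) $$ (i, j)
      = kronecker (map_mat to_ac A) (map_mat to_ac B) $$ (i, j)"
    using ij by (simp add: kronecker_def)
qed (auto simp: kronecker_def)

lemma map_mat_to_ac_kronecker_list: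
  assumes "As \<noteq> []"
  shows "map_mat to_ac (kronecker_list As) = kronecker_list (map (map_mat to_ac) As)"
  using assms
proof (induction As rule: rev_induct)
  case (snoc B As)
  then show ?case
    by (cases "As = []") (simp_all add: kronecker_list_append map_mat_to_ac_kronecker,
        simp add: kronecker_list_def)
qed simp

lemma order_prod_linear_powers:
  fixes e :: "'a :: field \<Rightarrow> nat"
  assumes "finite Z"
  shows "order w (\<Prod>z\<in>Z. [:- z, 1:] ^ e z) = (if w \<in> Z then e w else 0)"
  using assms
proof (induction Z rule: finite_induct)
  case (insert z Z)
  have nz: "(\<Prod>z\<in>Z. [:- z, 1:] ^ e z) \<noteq> 0" using insert.hyps(1) by auto
  have "order w ([:- z, 1:] ^ e z) = (if w = z then e z else 0)"
    by (simp add: order_power_n_n order_0I)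
  moreover have "order w ([:- z, 1:] ^ e z * (\<Prod>z\<in>Z. [:- z, 1:] ^ e z))
      = order w ([:- z, 1:] ^ e z) + order w (\<Prod>z\<in>Z. [:- z, 1:] ^ e z)"
    using nz by (intro order_mult) auto
  ultimately show ?case using insert by auto
qed simp

lemma monic_eqI_order:
  fixes p q :: "'a :: alg_closed_field poly"
  assumes "lead_coeff p = 1" "lead_coeff q = 1" "\<And>x. order x p = order x q"
  shows "p = q"
proof (rule poly_dvd_antisym)
  have nz: "p \<noteq> 0" "q \<noteq> 0" using assms by auto
  show "p dvd q" "q dvd p"
    using nz assms(3) by (simp_all add: dvd_iff_order_powers order_divides)
qed (use assms in simp)

abbreviation tuples_with_product :: "nat \<Rightarrow> 'b :: field \<Rightarrow> 'b list set" where
  "tuples_with_product m z \<equiv> {xs \<in> nonzero_tuples m. prod_list xs = z}"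

lemma tuples_with_product_nonempty:
  assumes "m \<ge> 1" "z \<noteq> 0"
  shows "tuples_with_product m z \<noteq> {}"
proof -
  have "z # replicate (m - 1) 1 \<in> tuples_with_product m z"
    using assms by (auto simp: nonzero_tuples_def prod_list_replicate)
  then show ?thesis by blast
qed

lemma same_product_class:
  assumes "xs \<in> nonzero_tuples m"
  shows "same_product m `` {xs} = tuples_with_product m (prod_list xs)"
proof (rule Set.set_eqI)
  fix ys
  have "ys \<in> same_product m `` {xs} \<longleftrightarrow> ys \<in> nonzero_tuples m \<and> prod_list xs = prod_list ys"
    using assms by (simp add: same_product_def)
  then show "ys \<in> same_product m `` {xs} \<longleftrightarrow> ys \<in> tuples_with_product m (prod_list xs)" by auto
qed

lemma product_classes_eq:
  assumes "m \<ge> 1"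
  shows "product_classes m = tuples_with_product m ` {z :: 'b :: field. z \<noteq> 0}"
proof (intro equalityI subsetI)
  fix \<Omega> :: "'b list set" assume "\<Omega> \<in> product_classes m"
  then obtain xs where xs: "xs \<in> nonzero_tuples m" "\<Omega> = same_product m `` {xs}"
    unfolding product_classes_def by (rule quotientE)
  have "prod_list xs \<noteq> 0" using xs(1) by (simp add: nonzero_tuples_def prod_list_zero_iff)
  then show "\<Omega> \<in> tuples_with_product m ` {z. z \<noteq> 0}"
    unfolding xs(2) same_product_class[OF xs(1)] by blast
next
  fix \<Omega> :: "'b list set" assume "\<Omega> \<in> tuples_with_product m ` {z. z \<noteq> 0}"
  then obtain z where z: "z \<noteq> 0" "\<Omega> = tuples_with_product m z" by blast
  obtain xs where xs: "xs \<in> nonzero_tuples m" "prod_list xs = z"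
    using tuples_with_product_nonempty[OF assms z(1)] by blast
  have "\<Omega> = same_product m `` {xs}"
    unfolding same_product_class[OF xs(1)] xs(2) by (rule z(2))
  then show "\<Omega> \<in> product_classes m"
    using quotientI[OF xs(1)] by (simp only: product_classes_def)
qed

lemma class_product_tuples:
  assumes "m \<ge> 1" "z \<noteq> 0"
  shows "class_product (tuples_with_product m z) = z"
proof -
  have "(SOME \<mu>. \<mu> \<in> tuples_with_product m z) \<in> tuples_with_product m z"
    unfolding some_in_eq by (rule tuples_with_product_nonempty[OF assms])
  then show ?thesis unfolding class_product_def by blast
qed

text \<open>
  The equivalence classes correspond to the nonzero elements of the field via their common product, so
  the product over classes becomes one over candidate roots.
\<close>
lemma Upsilon_eq_prod:
  fixes Ps :: "'a :: field poly list" and e :: "'a alg_closure \<Rightarrow> nat"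
  assumes "Ps \<noteq> []"
    and e: "\<And>z. z \<noteq> 0 \<Longrightarrow> class_exponent Ps (tuples_with_product (length Ps) z) = e z"
  shows "Upsilon Ps = (\<Prod>z\<in>{z. z \<noteq> 0 \<and> e z \<noteq> 0}. [:- z, 1:] ^ e z)"
proof -
  let ?m = "length Ps" and ?Z = "{z. z \<noteq> 0 \<and> e z \<noteq> 0}"
  have m: "?m \<ge> 1" using assms(1) by (cases Ps) auto
  have S: "{\<Omega> \<in> product_classes ?m. class_exponent Ps \<Omega> \<noteq> 0} = tuples_with_product ?m ` ?Z"
    unfolding product_classes_eq[OF m]
  proof (intro equalityI subsetI)
    fix \<Omega> assume "\<Omega> \<in> {\<Omega> \<in> tuples_with_product ?m ` {z. z \<noteq> 0}. class_exponent Ps \<Omega> \<noteq> 0}"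
    then obtain z where z: "\<Omega> = tuples_with_product ?m z" "z \<noteq> 0" and "class_exponent Ps \<Omega> \<noteq> 0" by blast
    then have "e z \<noteq> 0" using e[of z] by metis
    then show "\<Omega> \<in> tuples_with_product ?m ` ?Z" using z by blast
  next
    fix \<Omega> assume "\<Omega> \<in> tuples_with_product ?m ` ?Z"
    then obtain z where z: "\<Omega> = tuples_with_product ?m z" "z \<noteq> 0" and "e z \<noteq> 0" by blast
    then have "class_exponent Ps \<Omega> \<noteq> 0" using e[of z] by metis
    then show "\<Omega> \<in> {\<Omega> \<in> tuples_with_product ?m ` {z. z \<noteq> 0}. class_exponent Ps \<Omega> \<noteq> 0}"
      using z by blast
  qed
  have inj: "inj_on (tuples_with_product ?m) ?Z"
    by (rule inj_on_inverseI[of _ class_product]) (rule class_product_tuples[OF m], blast)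
  show ?thesis
    unfolding Upsilon_def S prod.reindex[OF inj] comp_def
  proof (rule prod.cong[OF refl])
    fix z assume "z \<in> ?Z"
    then have z: "z \<noteq> 0" by blast
    show "[:- class_product (tuples_with_product ?m z), 1:] ^ class_exponent Ps (tuples_with_product ?m z)
        = [:- z, 1:] ^ e z"
      unfolding class_product_tuples[OF m z] e[OF z] by (rule refl)
  qed
qed

lemma eq_1_iff_no_roots:
  fixes p :: "'a :: field poly"
  assumes "lead_coeff p = 1"
  shows "p = 1 \<longleftrightarrow> (\<forall>x. order x (map_poly to_ac p) = 0)"
proof
  assume *: "\<forall>x. order x (map_poly to_ac p) = 0"
  have "map_poly to_ac p = 1"
    by (rule monic_eqI_order) (use assms * in simp_all)
  then show "p = 1" by (metis to_ac_poly.hom_one to_ac_poly.injectivity)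
qed simp

theorem theorem2p7:
  fixes A :: "nat \<Rightarrow> 'a :: field mat"
    and Q :: "nat \<Rightarrow> 'a poly"
    and \<iota> :: "nat \<Rightarrow> nat"
    and m \<rho> :: nat
    and \<Theta> :: "nat set"
  assumes "m \<ge> 1"
    and "\<And>i. i \<in> {1..m} \<Longrightarrow> square_mat (A i)"
    and "\<And>i. i \<in> {1..m} \<Longrightarrow> minimal_poly (A i) = [:0, 1:] ^ \<iota> i * Q i"
    and "\<And>i. i \<in> {1..m} \<Longrightarrow> lead_coeff (Q i) = 1"
    and "\<And>i. i \<in> {1..m} \<Longrightarrow> poly (Q i) 0 \<noteq> 0"
    and "\<Theta> = {i \<in> {1..m}. Q i = 1}"
    and "\<rho> = (if \<Theta> \<noteq> {} then Min (\<iota> ` \<Theta>) else Max (\<iota> ` {1..m}))"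
  shows "map_poly to_ac (minimal_poly (kronecker_list (map A [1..<Suc m]))) =
           [:0, 1:] ^ \<rho> * Upsilon (map Q [1..<Suc m])"
proof -
  define I where "I = [1..<Suc m]"
  have I: "I \<noteq> []" "set I = {1..m}" "length I = m" using assms(1) by (auto simp: I_def)
  define B where "B i = map_mat to_ac (A i)" for i
  define L where "L = minimal_poly (kronecker_list (map B I))"
  have square: "\<forall>C\<in>set (map B I). square_mat C" "\<forall>C\<in>set (map A I). square_mat C"
    using assms(2) I by (auto simp: B_def)
  have L: "map_poly to_ac (minimal_poly (kronecker_list (map A I))) = L"
  proof -
    have "square_mat (kronecker_list (map A I))"
      using I square by (intro kronecker_list_square) auto
    moreover have "map_mat to_ac (kronecker_list (map A I)) = kronecker_list (map B I)"
      using I by (simp add: map_mat_to_ac_kronecker_list B_def[abs_def] comp_def)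
    ultimately show ?thesis
      unfolding L_def using minimal_poly_to_ac[OF square_mat_carrier] by metis
  qed
  have monic: "lead_coeff L = 1"
    unfolding L_def using I square
    by (intro minimal_poly_props(1)[OF square_mat_carrier] kronecker_list_square) auto
  then have L0: "L \<noteq> 0" by auto

  have minB: "minimal_poly (B i) = [:0, 1:] ^ \<iota> i * map_poly to_ac (Q i)" if "i \<in> {1..m}" for i
    using minimal_poly_to_ac[OF square_mat_carrier[OF assms(2)[OF that]]] assms(3)[OF that]
    by (simp add: B_def to_ac_poly.hom_mult to_ac_poly.hom_power map_poly_pCons)
  have Q0: "order 0 (map_poly to_ac (Q i)) = 0" if "i \<in> {1..m}" for i
    using assms(5)[OF that] by (intro order_0I) (metis to_ac.poly_map_poly_0 to_ac_eq_0_iff)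
  have ordB: "order x (minimal_poly (B i)) = (if x = 0 then \<iota> i else order x (map_poly to_ac (Q i)))"
    if "i \<in> {1..m}" for i x
  proof -
    have "Q i \<noteq> 0" using assms(4)[OF that] by auto
    then have "order x (minimal_poly (B i)) = order x ([:0, 1:] ^ \<iota> i) + order x (map_poly to_ac (Q i))"
      unfolding minB[OF that] by (intro order_mult) auto
    moreover have "order 0 ([:0, 1 :: 'a alg_closure:] ^ \<iota> i) = \<iota> i"
      using order_power_n_n[of "0 :: 'a alg_closure"] by simp
    ultimately show ?thesis using Q0[OF that] by (simp add: order_0I)
  qed
  \<comment> \<open>The indices in \<open>\<Theta>\<close> are those of the matrices without nonzero eigenvalues.\<close>
  have nil: "no_nonzero_eigenvalue (B i) \<longleftrightarrow> Q i = 1" if "i \<in> {1..m}" for i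
    unfolding no_nonzero_eigenvalue_def eq_1_iff_no_roots[OF assms(4)[OF that]]
    using ordB[OF that] Q0[OF that] by metis

  have "order 0 L = \<rho>"
  proof -
    have "{C \<in> set (map B I). no_nonzero_eigenvalue C} = B ` \<Theta>"
      using nil I assms(6) by auto
    moreover have "index_0 ` B ` \<Theta> = \<iota> ` \<Theta>" "index_0 ` set (map B I) = \<iota> ` {1..m}"
      using ordB I assms(6) by (auto simp: image_image intro!: image_cong)
    ultimately show ?thesis
      using index_0_kronecker_list[of "map B I"] I square assms(7) by (simp add: L_def)
  qed

  have exponent: "class_exponent (map Q I) (tuples_with_product (length (map Q I)) z) = order z L"
    if z: "z \<noteq> 0" for z
  proof -
    let ?T = "tuples_with_product m z"
    have mult: "wedge_multiplicity (map Q I) xs = wedges TYPE('a alg_closure) (minpoly_orders (map B I) xs)"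
      if "xs \<in> nonzero_tuples m" for xs
    proof -
      have "map2 root_multiplicity (map Q I) xs = minpoly_orders (map B I) xs"
      proof (rule nth_equalityI)
        fix k assume "k < length (map2 root_multiplicity (map Q I) xs)"
        then have k: "k < m" "k < length xs" using that I by (auto simp: nonzero_tuples_def)
        have "xs ! k \<noteq> 0"
          using that nth_mem[OF k(2)] by (auto simp: nonzero_tuples_def)
        moreover have "I ! k \<in> {1..m}" using nth_mem[of k I] k(1) I by metis
        ultimately show "map2 root_multiplicity (map Q I) xs ! k = minpoly_orders (map B I) xs ! k"
          using k I ordB by (simp add: root_multiplicity_def)
      qed simp
      then show ?thesis by (simp add: wedge_multiplicity_def wedges_def wedge_alg_closure)
    qed
    have le: "wedge_multiplicity (map Q I) xs \<le> order z L" if "xs \<in> ?T" for xs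
      using wedges_le_order_kronecker_list[of "map B I" xs] that square I mult[of xs]
      by (auto simp: L_def nonzero_tuples_def)
    obtain ys where ys: "ys \<in> ?T" using tuples_with_product_nonempty[OF assms(1) z] by blast
    \<comment> \<open>If \<open>z\<close> is no root, any tuple attains the maximum, which is then 0.\<close>
    have att: "\<exists>xs\<in>?T. wedge_multiplicity (map Q I) xs = order z L"
    proof (cases "order z L > 0")
      case True
      then obtain xs where "length xs = m" "0 \<notin> set xs" "prod_list xs = z"
        "wedges TYPE('a alg_closure) (minpoly_orders (map B I) xs) = order z L"
        using order_kronecker_list_attained[of "map B I" z] square I z by (auto simp: L_def)
      then show ?thesis using mult[of xs] by (intro bexI[of _ xs]) (auto simp: nonzero_tuples_def)
    next
      case False
      then show ?thesis using ys le[OF ys] by (intro bexI[of _ ys]) auto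
    qed
    have "Max (wedge_multiplicity (map Q I) ` ?T) = order z L"
    proof (rule Max_eqI)
      show "finite (wedge_multiplicity (map Q I) ` ?T)"
        by (rule finite_subset[of _ "{..order z L}"]) (use le in auto)
    qed (use le att in force)+
    then show ?thesis using I by (simp add: class_exponent_def)
  qed

  let ?Z = "{z. z \<noteq> 0 \<and> order z L \<noteq> 0}"
  have fin: "finite ?Z"
    by (rule finite_subset[OF _ poly_roots_finite[OF L0]]) (auto simp: order_root)
  have U: "Upsilon (map Q I) = (\<Prod>z\<in>?Z. [:- z, 1:] ^ order z L)"
    using I exponent by (intro Upsilon_eq_prod) auto
  have "L = [:0, 1:] ^ \<rho> * Upsilon (map Q I)"
  proof (rule monic_eqI_order)
    show "lead_coeff ([:0, 1:] ^ \<rho> * Upsilon (map Q I)) = 1"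
      unfolding U by (simp add: lead_coeff_mult lead_coeff_power lead_coeff_prod)
    fix x
    have "Upsilon (map Q I) \<noteq> 0" unfolding U using fin by auto
    then have "order x ([:0, 1:] ^ \<rho> * Upsilon (map Q I)) = order x ([:0, 1:] ^ \<rho>) + order x (Upsilon (map Q I))"
      by (intro order_mult) auto
    moreover have "order x (Upsilon (map Q I)) = (if x \<noteq> 0 then order x L else 0)"
      unfolding U using order_prod_linear_powers[OF fin, of x "\<lambda>z. order z L"] by auto
    moreover have "order x ([:0, 1 :: 'a alg_closure:] ^ \<rho>) = (if x = 0 then \<rho> else 0)"
      using order_power_n_n[of "0 :: 'a alg_closure" \<rho>] by (simp add: order_0I)
    ultimately show "order x L = order x ([:0, 1:] ^ \<rho> * Upsilon (map Q I))"
      using \<open>order 0 L = \<rho>\<close> by simp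
  qed (rule monic)
  then show ?thesis using L unfolding I_def by simp
qed

end
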